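(* Let $n\ge 2$, $1<p_1,\ldots,p_n<\infty$, let $\mathcal{S}\subset\mathcal{D}$ be an $\eta$-sparse family ($0<\eta<1$), and let $K(S)=\ell_S^{\alpha-(n-1)d}$ for $S\in\mathcal{S}$, with $0<\alpha<(n-1)d$. (a) Suppose that $\frac1{p_1}+\cdots+\frac1{p_n}\ge 1$. Let $\sigma_i(x)=|x|^{\beta_i}$ with $\beta_i>-d$, $i=1,\ldots,n$. Then $$\sup_{S\in\mathcal{S}}K(S)|S|^{n-1/p_1-\cdots-1/p_n}\prod_{i=1}^n\left(\frac{\sigma_i(S)}{|S|}\right)^{1/p_i'}<\infty$$ provided that $$\alpha+d\left(1-\frac1{p_1}-\cdots-\frac1{p_n}\right)+\frac{\beta_1}{p_1'}+\cdots+\frac{\beta_n}{p_n'}=0.$$ (b) Suppose that $\frac1{p_1}+\cdots+\frac1{p_n}<1$ and define $r$ by $\frac1r+\frac1{p_1}+\cdots+\frac1{p_n}=1$. Let $\sigma_i(x)=|x|^{\beta_i}\max(|x|,1)^{p_i'\rho/n}$ with $\rho<-d/r$ and $\beta_i+p_i'\rho/n>-d$, $i=1,\ldots,n$. Then $$\left[\sum_{S\in\mathcal{S}}\left(K(S)|S|^{n-1}\prod_{i=1}^n\left(\frac{\sigma_i(S)}{|S|}\right)^{1/p_i'}\right)^r|E_{\mathcal{S}}(S)|\right]^{1/r}<\infty$$ provided that $$\alpha+\frac{\beta_1}{p_1'}+\cdots+\frac{\beta_n}{p_n'}=0.$$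
   Context: $\mathcal{D}=\{2^{-k}(m+[0,1)^d):k\in\mathbb{Z},m\in\mathbb{Z}^d\}$ is the family of dyadic cubes in $\mathbb{R}^d$; $\ell_S$ is the side length of a cube $S$ and $|E|$ is the Lebesgue measure of $E$. For $0<\eta<1$, a family $\mathcal{S}\subset\mathcal{D}$ is $\eta$-sparse if for every $S\in\mathcal{S}$ there is a measurable set $E_{\mathcal{S}}(S)\subset S$ with $|E_{\mathcal{S}}(S)|\ge\eta|S|$, and the sets $\{E_{\mathcal{S}}(S):S\in\mathcal{S}\}$ are pairwise disjoint; a choice of these sets is fixed. For a nonnegative locally integrable function $\sigma$, $\sigma(S)=\int_S\sigma\,dx$. The conjugate exponent is $p'=p/(p-1)$.
   Formalization: Part (a) is proved under the added condition α + d(1 − 1/p_1 − … − 1/p_n) ≥ 0; without it the claim fails for the family of all unit dyadic cubes (e.g. n=2, d=1, p_1=p_2=4/3, α=1/4, β_1=β_2=1/2). *)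

theory Defs
  imports "HOL-Analysis.Analysis"
begin

definition dyadic_cube :: "int \<Rightarrow> int ^ 'd \<Rightarrow> (real ^ 'd) set" where
  "dyadic_cube k m =
     (\<lambda>x. (2 powi (- k)) *\<^sub>R ((\<chi> i. real_of_int (m $ i)) + x)) ` {x. \<forall>i. 0 \<le> x $ i \<and> x $ i < 1}"

definition dyadic_cubes :: "(real ^ 'd) set set" where
  "dyadic_cubes = {dyadic_cube k m | k m. True}"

definition side_length :: "(real ^ 'd) set \<Rightarrow> real" where
  "side_length S = (THE l. \<exists>k m. S = dyadic_cube k m \<and> l = 2 powi (- k))"

text \<open>The sets \<open>E S\<close> are carried as an argument: they are the fixed choice of major subsets.\<close>

definition sparse_family ::
    "real \<Rightarrow> (real ^ 'd) set set \<Rightarrow> ((real ^ 'd) set \<Rightarrow> (real ^ 'd) set) \<Rightarrow> bool" where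
  "sparse_family \<eta> F E \<longleftrightarrow>
     F \<subseteq> dyadic_cubes \<and>
     (\<forall>S\<in>F. E S \<in> sets lebesgue \<and> E S \<subseteq> S \<and>
            emeasure lebesgue (E S) \<ge> ennreal \<eta> * emeasure lebesgue S) \<and>
     disjoint_family_on E F"

definition weight :: "(real ^ 'd \<Rightarrow> real) \<Rightarrow> (real ^ 'd) set \<Rightarrow> ennreal" where
  "weight \<sigma> S = (\<integral>\<^sup>+x\<in>S. ennreal (\<sigma> x) \<partial>lebesgue)"

definition conjugate_exponent :: "real \<Rightarrow> real" where
  "conjugate_exponent p = p / (p - 1)"

text \<open>Real powers on \<open>[0,\<infinity>]\<close>, meant for exponents \<open>s > 0\<close> only.\<close>

definition epowr :: "ennreal \<Rightarrow> real \<Rightarrow> ennreal" where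
  "epowr x s = (if x = \<infinity> then \<infinity> else ennreal (enn2real x powr s))"

lemma mem_dyadic_cube:
  "x \<in> dyadic_cube k m \<longleftrightarrow>
     (\<forall>i. 2 powi (- k) * real_of_int (m $ i) \<le> x $ i \<and>
          x $ i < 2 powi (- k) * (real_of_int (m $ i) + 1))"
proof -
  define l :: real where "l = 2 powi (- k)"
  have l: "l > 0" by (simp add: l_def)
  show ?thesis
    unfolding l_def[symmetric]
  proof
    assume "x \<in> dyadic_cube k m"
    then obtain y where y: "\<And>i. 0 \<le> y $ i \<and> y $ i < 1"
      and x: "x = l *\<^sub>R ((\<chi> i. real_of_int (m $ i)) + y)"
      unfolding dyadic_cube_def l_def by auto
    show "\<forall>i. l * real_of_int (m $ i) \<le> x $ i \<and> x $ i < l * (real_of_int (m $ i) + 1)"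
      using y l by (auto simp: x)
  next
    assume a: "\<forall>i. l * real_of_int (m $ i) \<le> x $ i \<and> x $ i < l * (real_of_int (m $ i) + 1)"
    define y where "y = (\<chi> i. x $ i / l - real_of_int (m $ i))"
    have "x = l *\<^sub>R ((\<chi> i. real_of_int (m $ i)) + y)"
      using l by (simp add: vec_eq_iff y_def)
    moreover have "\<forall>i. 0 \<le> y $ i \<and> y $ i < 1"
      using a l by (auto simp: y_def field_simps)
    ultimately show "x \<in> dyadic_cube k m"
      unfolding dyadic_cube_def l_def by blast
  qed
qed

lemma dyadic_cube_eq_imp_side_le:
  fixes m m' :: "int ^ 'd"
  assumes eq: "dyadic_cube k m = dyadic_cube k' m'"
  shows "(2::real) powi (- k') \<le> 2 powi (- k)"
proof (rule ccontr)
  define l l' :: real where "l = 2 powi (- k)" and "l' = 2 powi (- k')"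
  assume "\<not> ?thesis"
  then have ll: "l < l'" by (simp add: l_def l'_def)
  have pos: "l > 0" "l' > 0" by (simp_all add: l_def l'_def)
  have mem: "x \<in> dyadic_cube k m \<longleftrightarrow>
      (\<forall>i. l * of_int (m $ i) \<le> x $ i \<and> x $ i < l * (of_int (m $ i) + 1))"
    and mem': "x \<in> dyadic_cube k m \<longleftrightarrow>
      (\<forall>i. l' * of_int (m' $ i) \<le> x $ i \<and> x $ i < l' * (of_int (m' $ i) + 1))" for x
    unfolding l_def l'_def by (rule mem_dyadic_cube, unfold eq, rule mem_dyadic_cube)
  define a a' :: "real ^ 'd"
    where "a = (\<chi> i. l * of_int (m $ i))" and "a' = (\<chi> i. l' * of_int (m' $ i))"
  have "a \<in> dyadic_cube k m" using pos by (subst mem) (simp add: a_def)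
  then have 1: "a' $ i \<le> a $ i" for i by (subst (asm) mem') (simp add: a'_def)
  have "a' \<in> dyadic_cube k m" using pos by (subst mem') (simp add: a'_def)
  then have 2: "a $ i \<le> a' $ i" for i by (subst (asm) mem) (simp add: a_def)
  have c: "l * of_int (m $ i) = l' * of_int (m' $ i)" for i
    using 1[of i] 2[of i] by (simp add: a_def a'_def)
  define b :: "real ^ 'd" where "b = (\<chi> i. l * (of_int (m $ i) + 1))"
  have "b \<in> dyadic_cube k m" using pos ll by (subst mem') (simp add: b_def c distrib_left)
  then show False by (subst (asm) mem) (simp add: b_def)
qed

lemma side_length_dyadic_cube: "side_length (dyadic_cube k m) = 2 powi (- k)"
  unfolding side_length_def
  by (rule the_equality) (auto intro: antisym dyadic_cube_eq_imp_side_le)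

end

theory Submission imports Defs begin

(* Let R be the size of the largest |x| on a dyadic cube S, up to a dimensional constant, so that
   the side length l of S is at most R. If S is far from the origin compared with l, then |x| is
   comparable with R on S; otherwise R is comparable with l, and S lies in a ball of radius
   comparable with l. In both cases the average of |x|^b max(|x|,1)^t over S is at most a constant
   times R^b max(R,1)^t. Under the balance conditions the expressions in (a) and (b) reduce to
   (l/R)^c with c = alpha + d (1 - sum 1/p_i) >= 0, and to (l/R)^alpha max(R,1)^rho. In (b) the
   r-th power of the latter is at most max(|x|,1)^(rho r) at every x in S, so by disjointness of
   the sets E S the sum is dominated by the integral of this function over the whole space,
   which converges because rho r < -d. *)

section \<open>Dyadic shells and integrals of powers of the norm\<close>

text \<open>Rounding down to an integer \<open>k\<close> loses nothing:
  \<open>k < 2 ^ (j + 1)\<close> gives \<open>k + 1 \<le> 2 ^ (j + 1)\<close>, which also covers the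
  fractional part. The bracket assigns points to dyadic shells, both towards the origin and towards
  infinity.\<close>

lemma power_of_two_bracket:
  fixes y :: real
  assumes "1 \<le> y"
  obtains j :: nat where "2 ^ j \<le> y" "y \<le> 2 * 2 ^ j"
proof -
  define k where "k = nat \<lfloor>y\<rfloor>"
  have k: "real k \<le> y" "y < real k + 1" "1 \<le> k"
    using assms by (auto simp: k_def le_nat_iff)
  obtain j where j: "2 ^ j \<le> k" "k < 2 ^ (j + 1)"
    using ex_power_ivl1[of 2 k] k(3) by auto
  have "real (2 ^ j) \<le> real k" "real (k + 1) \<le> real (2 ^ (j + 1))"
    unfolding of_nat_le_iff using j by auto
  then have "2 ^ j \<le> real k" "real k + 1 \<le> 2 * 2 ^ j"
    by (simp_all only: of_nat_power of_nat_numeral of_nat_mult of_nat_add of_nat_1 power_add power_one_right mult.commute)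
  then show thesis
    using k by (intro that[of j]; linarith)
qed

text \<open>For \<beta> \<ge> 0 the power is largest at \<open>s\<close>, for \<beta> < 0 at
  \<open>s / 2\<close>; the absolute value in the exponent of 2 gives one constant for both
  signs.\<close>

lemma powr_le_of_comparable:
  fixes s y \<beta> :: real
  assumes "0 < s" "s \<le> 2 * y" "y \<le> s"
  shows "y powr \<beta> \<le> 2 powr \<bar>\<beta>\<bar> * s powr \<beta>"
proof (cases "\<beta> \<ge> 0")
  case True
  have "y powr \<beta> \<le> s powr \<beta>" using assms True by (intro powr_mono2) auto
  also have "\<dots> \<le> 2 powr \<bar>\<beta>\<bar> * s powr \<beta>"
    by (rule mult_le_cancel_right1[THEN iffD2]) (auto simp: ge_one_powr_ge_zero)
  finally show ?thesis .
next
  case False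
  have "y powr \<beta> \<le> (s / 2) powr \<beta>"
    using assms False by (intro powr_mono2') auto
  also have "\<dots> = 2 powr \<bar>\<beta>\<bar> * s powr \<beta>"
    using False \<open>0 < s\<close> by (simp add: powr_divide powr_minus_divide)
  finally show ?thesis .
qed

text \<open>On the shell of outer radius \<open>R * b ^ j\<close> the integrand is comparable with
  the power of that radius. Enlarging each shell to the full ball turns the bound into a geometric
  series with ratio \<open>b powr (\<beta> + DIM('a))\<close>. The choice b = 1/2 treats the
  singularity at the origin, b = 2 the decay at infinity.\<close>

lemma nn_integral_norm_powr_geometric:
  fixes A :: "'a::euclidean_space set" and b R \<beta> :: real
  assumes "b > 0" "R > 0" and q: "b powr (\<beta> + DIM('a)) < 1"
    and cover: "\<And>x. x \<in> A \<Longrightarrow> x \<noteq> 0 \<Longrightarrow> \<exists>j::nat. R * b ^ j \<le> 2 * norm x \<and> norm x \<le> R * b ^ j"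
  shows "(\<integral>\<^sup>+x\<in>A. ennreal (norm x powr \<beta>) \<partial>lebesgue)
    \<le> ennreal (2 powr \<bar>\<beta>\<bar> * unit_ball_vol DIM('a) / (1 - b powr (\<beta> + DIM('a))) * R powr (\<beta> + DIM('a)))"
proof -
  define D where "D = real DIM('a)"
  define V where "V = unit_ball_vol D"
  define s where "s j = R * b ^ j" for j :: nat
  define c where "c j = 2 powr \<bar>\<beta>\<bar> * s j powr \<beta>" for j
  define t where "t j x = ennreal (c j) * indicator (cball 0 (s j)) x" for j and x :: 'a
  have s: "s j > 0" for j using assms by (simp add: s_def)
  have V: "V \<ge> 0" by (simp add: V_def D_def)
  have c: "c j \<ge> 0" for j by (simp add: c_def)
  have "(\<integral>\<^sup>+x\<in>A. ennreal (norm x powr \<beta>) \<partial>lebesgue)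
      \<le> (\<integral>\<^sup>+(x::'a). (\<Sum>j. ennreal (c j) * indicator (cball 0 (s j)) x) \<partial>lebesgue)"
  proof (rule nn_integral_mono)
    fix x :: 'a
    show "ennreal (norm x powr \<beta>) * indicator A x \<le> (\<Sum>j. ennreal (c j) * indicator (cball 0 (s j)) x)"
    proof (cases "x \<in> A \<and> x \<noteq> 0")
      case True
      then obtain j where j: "s j \<le> 2 * norm x" "norm x \<le> s j"
        using cover unfolding s_def by blast
      have "norm x powr \<beta> \<le> c j"
        using powr_le_of_comparable[OF s j] by (simp add: c_def)
      then have "ennreal (norm x powr \<beta>) * indicator A x \<le> t j x"
        using True j by (simp add: t_def ennreal_leI)
      also have "\<dots> = (\<Sum>j\<in>{j}. t j x)" by simp
      also have "\<dots> \<le> (\<Sum>j. t j x)" by (intro sum_le_suminf) auto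
      finally show ?thesis by (simp add: t_def)
    next
      case False
      \<comment> \<open>The origin lies in no shell, but \<open>0 powr \<beta>\<close> is 0 for
        every \<beta>, so it contributes nothing.\<close>
      then show ?thesis by (cases "x = 0") (auto simp: indicator_def)
    qed
  qed
  also have "\<dots> = (\<Sum>j. ennreal (c j) * emeasure lebesgue (cball (0::'a) (s j)))"
  proof (subst nn_integral_suminf)
    show "(\<lambda>x. ennreal (c j) * indicator (cball (0::'a) (s j)) x) \<in> borel_measurable lebesgue" for j
      by (intro borel_measurable_times_ennreal borel_measurable_indicator) auto
  qed (simp add: nn_integral_cmult_indicator)
  also have "\<dots> = (\<Sum>j. ennreal (2 powr \<bar>\<beta>\<bar> * V * R powr (\<beta> + D) * (b powr (\<beta> + D)) ^ j))"
  proof (rule suminf_cong)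
    fix j
    have "ennreal (c j) * emeasure lebesgue (cball (0::'a) (s j)) = ennreal (c j * (V * s j ^ DIM('a)))"
      using s[of j] c[of j] V
      by (simp add: emeasure_cball ennreal_mult V_def D_def)
    also have "s j ^ DIM('a) = s j powr D"
      using s[of j] by (simp add: D_def powr_realpow)
    also have "c j * (V * s j powr D) = 2 powr \<bar>\<beta>\<bar> * V * s j powr (\<beta> + D)"
      by (simp add: c_def powr_add)
    also have "s j powr (\<beta> + D) = R powr (\<beta> + D) * (b powr (\<beta> + D)) ^ j"
    proof -
      have "(b ^ j) powr (\<beta> + D) = (b powr (\<beta> + D)) ^ j"
        using assms(1) by (induction j) (auto simp: powr_mult)
      then show ?thesis using assms(1,2) by (simp add: s_def powr_mult)
    qed
    finally show "ennreal (c j) * emeasure lebesgue (cball (0::'a) (s j))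
        = ennreal (2 powr \<bar>\<beta>\<bar> * V * R powr (\<beta> + D) * (b powr (\<beta> + D)) ^ j)"
      by (simp add: mult.assoc)
  qed
  also have "\<dots> = ennreal (2 powr \<bar>\<beta>\<bar> * V * R powr (\<beta> + D) * (1 / (1 - b powr (\<beta> + D))))"
    using V q unfolding D_def[symmetric]
    by (intro suminf_ennreal_eq sums_mult geometric_sums) auto
  finally show ?thesis by (simp add: V_def D_def mult_ac)
qed

text \<open>Shells shrink to the origin with ratio 1/2, and \<beta> > -d makes the series converge;
  \<open>C\<close> does not depend on \<open>R\<close>, which enters only through scaling.\<close>

lemma nn_integral_cball_norm_powr:
  fixes \<beta> :: real
  assumes "\<beta> > - real DIM('a)"
  obtains C where "C \<ge> 0"
    and "\<And>R. R > 0 \<Longrightarrow> (\<integral>\<^sup>+x\<in>cball (0::'a::euclidean_space) R. ennreal (norm x powr \<beta>) \<partial>lebesgue)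
      \<le> ennreal (C * R powr (\<beta> + DIM('a)))"
proof
  let ?q = "(1/2) powr (\<beta> + DIM('a)) :: real"
  have q: "?q < 1" using assms by (simp add: powr_divide)
  show "2 powr \<bar>\<beta>\<bar> * unit_ball_vol DIM('a) / (1 - ?q) \<ge> 0" using q by simp
  fix R :: real assume R: "R > 0"
  show "(\<integral>\<^sup>+x\<in>cball (0::'a) R. ennreal (norm x powr \<beta>) \<partial>lebesgue)
      \<le> ennreal (2 powr \<bar>\<beta>\<bar> * unit_ball_vol DIM('a) / (1 - ?q) * R powr (\<beta> + DIM('a)))"
  proof (rule nn_integral_norm_powr_geometric[OF _ R q])
    fix x :: 'a assume x: "x \<in> cball 0 R" "x \<noteq> 0"
    then have "1 \<le> R / norm x" by simp
    then obtain j :: nat where "2 ^ j \<le> R / norm x" "R / norm x \<le> 2 * 2 ^ j"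
      by (rule power_of_two_bracket)
    then show "\<exists>j::nat. R * (1/2) ^ j \<le> 2 * norm x \<and> norm x \<le> R * (1/2) ^ j"
      using x by (intro exI[of _ j]) (simp add: field_simps power_one_over)
  qed simp
qed

text \<open>The integrand is 1 on the unit ball; outside it, growing shells give a series of ratio
  \<open>2 powr (\<beta> + DIM('a))\<close>, below 1 since \<beta> < -d.\<close>

lemma nn_integral_max_norm_powr_finite:
  fixes \<beta> :: real
  assumes "\<beta> < - real DIM('a)"
  shows "(\<integral>\<^sup>+(x::'a::euclidean_space). ennreal (max (norm x) 1 powr \<beta>) \<partial>lebesgue) < \<infinity>"
proof -
  have q: "2 powr (\<beta> + DIM('a)) < (1::real)" using assms by (simp add: powr_less_one)
  have "(\<integral>\<^sup>+(x::'a). ennreal (max (norm x) 1 powr \<beta>) \<partial>lebesgue)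
      \<le> (\<integral>\<^sup>+(x::'a). indicator (cball 0 1) x + ennreal (norm x powr \<beta>) * indicator (- ball 0 1) x \<partial>lebesgue)"
    by (intro nn_integral_mono) (auto simp: indicator_def max_def)
  also have "\<dots> = emeasure lebesgue (cball (0::'a) 1)
      + (\<integral>\<^sup>+x\<in>- ball (0::'a) 1. ennreal (norm x powr \<beta>) \<partial>lebesgue)"
  proof (subst nn_integral_add)
    show "(\<lambda>x::'a. ennreal (norm x powr \<beta>) * indicator (- ball 0 1) x) \<in> borel_measurable lebesgue"
      by (intro borel_measurable_times_ennreal borel_measurable_indicator measurable_completion) measurable
    show "indicator (cball (0::'a) 1) \<in> borel_measurable lebesgue"
      by (intro borel_measurable_indicator) auto
  qed auto
  also have "(\<integral>\<^sup>+x\<in>- ball (0::'a) 1. ennreal (norm x powr \<beta>) \<partial>lebesgue) < \<infinity>"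
  \<comment> \<open>Radii in the series are outer radii: the first shell is 1 \<le> |x| \<le> 2,
    hence the initial radius 2.\<close>
  proof (rule le_less_trans[OF nn_integral_norm_powr_geometric[OF _ _ q, of 2]])
    fix x :: 'a assume "x \<in> - ball 0 1"
    then have "1 \<le> norm x" by simp
    then obtain j :: nat where "2 ^ j \<le> norm x" "norm x \<le> 2 * 2 ^ j"
      by (rule power_of_two_bracket)
    then show "\<exists>j::nat. 2 * 2 ^ j \<le> 2 * norm x \<and> norm x \<le> 2 * 2 ^ j" by auto
  qed auto
  finally show ?thesis
    by (simp add: emeasure_cball)
qed

section \<open>Sums over disjoint sets and powers of extended reals\<close>

text \<open>For a finite subfamily the sum is the integral over a disjoint union. In
  \<open>ennreal\<close> the infinite sum is the supremum of the finite ones, so the bound carries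
  over.\<close>

lemma infsum_nn_integral_disjoint_le:
  fixes h :: "'a \<Rightarrow> ennreal"
  assumes h: "h \<in> borel_measurable M"
    and E: "\<And>S. S \<in> F \<Longrightarrow> E S \<in> sets M"
    and disj: "disjoint_family_on E F"
  shows "(\<Sum>\<^sub>\<infinity>S\<in>F. \<integral>\<^sup>+x\<in>E S. h x \<partial>M) \<le> (\<integral>\<^sup>+x. h x \<partial>M)"
proof -
  have "(\<Sum>S\<in>G. \<integral>\<^sup>+x\<in>E S. h x \<partial>M) \<le> (\<integral>\<^sup>+x. h x \<partial>M)" if G: "finite G" "G \<subseteq> F" for G
  proof -
    have "(\<Sum>S\<in>G. \<integral>\<^sup>+x\<in>E S. h x \<partial>M) = (\<integral>\<^sup>+x. (\<Sum>S\<in>G. h x * indicator (E S) x) \<partial>M)"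
      using G E h by (subst nn_integral_sum) auto
    also have "\<dots> = (\<integral>\<^sup>+x. h x * indicator (\<Union>S\<in>G. E S) x \<partial>M)"
      using G disjoint_family_on_mono[OF G(2) disj]
      by (simp add: indicator_UN_disjoint sum_distrib_left)
    also have "\<dots> \<le> (\<integral>\<^sup>+x. h x \<partial>M)"
      by (intro nn_integral_mono) (auto simp: indicator_def)
    finally show ?thesis .
  qed
  then show ?thesis
    by (intro infsum_le_finite_sums nonneg_summable_on_complete) auto
qed

lemma epowr_le:
  assumes "x \<le> ennreal y" "0 < s"
  shows "epowr x s \<le> ennreal (y powr s)"
proof (cases "y \<ge> 0")
  case True
  have "x \<noteq> \<infinity>" using assms(1) by (auto simp: top_unique)
  moreover have "enn2real x powr s \<le> y powr s"
    using assms True by (intro powr_mono2) (auto intro: enn2real_leI)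
  ultimately show ?thesis by (simp add: epowr_def ennreal_leI)
next
  case False
  \<comment> \<open>\<open>ennreal\<close> sends negative reals to 0, and the power of 0 is
    0.\<close>
  then have "x = 0" using assms(1) by (simp add: ennreal_neg)
  then show ?thesis by (simp add: epowr_def)
qed

section \<open>Volume and position of dyadic cubes\<close>

text \<open>The half-open cube is a finite intersection of half-spaces and lies between an open and
  a closed box of the same volume.\<close>

lemma emeasure_dyadic_cube:
  fixes m :: "int ^ 'd"
  shows "dyadic_cube k m \<in> sets lebesgue"
    and "emeasure lebesgue (dyadic_cube k m) = ennreal ((2 powi (- k)) ^ CARD('d))"
proof -
  define l :: real where "l = 2 powi (- k)"
  have l: "l > 0" by (simp add: l_def)
  define a b :: "real ^ 'd"
    where "a = (\<chi> i. l * of_int (m $ i))" and "b = (\<chi> i. l * (of_int (m $ i) + 1))"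
  have sub: "box a b \<subseteq> dyadic_cube k m" "dyadic_cube k m \<subseteq> cbox a b"
    by (auto simp: mem_dyadic_cube mem_box_cart a_def b_def l_def less_imp_le)
  have "dyadic_cube k m = (\<Inter>i. {x. l * real_of_int (m $ i) \<le> x $ i} \<inter> {x. x $ i < l * (real_of_int (m $ i) + 1)})"
    by (auto simp: mem_dyadic_cube l_def)
  also have "\<dots> \<in> sets borel"
    by (intro sets.countable_INT'' sets.Int borel_closed borel_open
        closed_halfspace_component_ge_cart open_halfspace_component_lt_cart) auto
  finally have "dyadic_cube k m \<in> sets lborel" by simp
  then show S: "dyadic_cube k m \<in> sets lebesgue" by simp
  have ab: "a \<bullet> e \<le> b \<bullet> e" "(b - a) \<bullet> e = l" if "e \<in> Basis" for e
    using that l by (auto simp: Basis_vec_def inner_axis a_def b_def algebra_simps)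
  have vol: "emeasure lebesgue (box a b) = ennreal (l ^ CARD('d))"
    "emeasure lebesgue (cbox a b) = ennreal (l ^ CARD('d))"
    using ab by (simp_all add: emeasure_lborel_box emeasure_lborel_cbox)
  show "emeasure lebesgue (dyadic_cube k m) = ennreal ((2 powi (- k)) ^ CARD('d))"
    unfolding l_def[symmetric]
    using emeasure_mono[OF sub(1) S] emeasure_mono[OF sub(2), of lebesgue] vol by auto
qed

text \<open>The norm of the lower corner plus d side lengths, an upper bound for the diameter: this
  bounds |x| on the cube and is never smaller than the side.\<close>

definition cube_radius :: "int \<Rightarrow> int ^ 'd \<Rightarrow> real" where
  "cube_radius k m =
     norm (\<chi> i. 2 powi (- k) * real_of_int (m $ i)) + real CARD('d) * 2 powi (- k)"

lemma side_le_cube_radius: "2 powi (- k) \<le> cube_radius k (m :: int ^ 'd)"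
proof -
  have "1 * 2 powi (- k) \<le> real CARD('d) * 2 powi (- k)"
    by (intro mult_right_mono) (auto simp: Suc_leI)
  then show ?thesis
    unfolding cube_radius_def by (smt (verit) norm_ge_zero)
qed

lemma cube_radius_pos: "0 < cube_radius k m"
  using side_le_cube_radius[of k m] by (rule less_le_trans[rotated]) simp

text \<open>Each coordinate of \<open>x\<close> differs from that of the corner by at most the side
  length, so the Euclidean distance is at most the l1 distance, hence at most d sides. The factor 2
  adds this error to the d sides already present in \<open>cube_radius\<close>.\<close>

lemma norm_dyadic_cube:
  fixes m :: "int ^ 'd"
  assumes "x \<in> dyadic_cube k m"
  shows "norm x \<le> cube_radius k m"
    and "cube_radius k m \<le> norm x + 2 * (real CARD('d) * 2 powi (- k))"
proof -
  define l :: real where "l = 2 powi (- k)"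
  define a :: "real ^ 'd" where "a = (\<chi> i. l * of_int (m $ i))"
  have "\<bar>(x - a) $ i\<bar> \<le> l" for i
    using assms by (simp add: mem_dyadic_cube a_def l_def distrib_left abs_le_iff) (smt (verit))
  then have "norm (x - a) \<le> (\<Sum>i::'d\<in>UNIV. l)"
    by (intro order_trans[OF norm_le_l1_cart] sum_mono) auto
  then have "norm (x - a) \<le> real CARD('d) * l" by simp
  moreover have "norm x \<le> norm a + norm (x - a)" "norm a \<le> norm x + norm (x - a)"
    by norm+
  ultimately show "norm x \<le> cube_radius k m"
    "cube_radius k m \<le> norm x + 2 * (real CARD('d) * 2 powi (- k))"
    by (simp_all add: cube_radius_def a_def l_def)
qed

section \<open>Averages of the weights over dyadic cubes\<close>

text \<open>Far cubes allow a pointwise bound. For near cubes the integral over the ball of radius R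
  suffices, as its volume is comparable with that of the cube; there \<beta> > -d serves R \<le> 1
  and \<beta> + \<tau> > -d serves R > 1.\<close>

lemma weight_average_le:
  fixes \<beta> \<tau> :: real
  assumes "\<beta> > - real CARD('d)" "\<tau> \<le> 0" "\<beta> + \<tau> > - real CARD('d)"
  obtains C where "C \<ge> 0"
    and "\<And>k (m :: int ^ 'd). weight (\<lambda>x. norm x powr \<beta> * max (norm x) 1 powr \<tau>) (dyadic_cube k m)
        / emeasure lebesgue (dyadic_cube k m)
      \<le> ennreal (C * (cube_radius k m powr \<beta> * max (cube_radius k m) 1 powr \<tau>))"
proof -
  define D where "D = real CARD('d)"
  have D: "D \<ge> 1" by (simp add: D_def Suc_leI)
  have dim: "DIM(real ^ 'd) = CARD('d)" by simp
  obtain C1 where C1: "C1 \<ge> 0"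
    "\<And>R. R > 0 \<Longrightarrow> (\<integral>\<^sup>+x\<in>cball (0::real ^ 'd) R. ennreal (norm x powr \<beta>) \<partial>lebesgue)
      \<le> ennreal (C1 * R powr (\<beta> + D))"
    using nn_integral_cball_norm_powr[where 'a="real ^ 'd" and \<beta>=\<beta>] assms unfolding dim D_def by blast
  obtain C2 where C2: "C2 \<ge> 0"
    "\<And>R. R > 0 \<Longrightarrow> (\<integral>\<^sup>+x\<in>cball (0::real ^ 'd) R. ennreal (norm x powr (\<beta> + \<tau>)) \<partial>lebesgue)
      \<le> ennreal (C2 * R powr (\<beta> + \<tau> + D))"
    using nn_integral_cball_norm_powr[where 'a="real ^ 'd" and \<beta>="\<beta>+\<tau>"] assms unfolding dim D_def by blast
  \<comment> \<open>The first summand is the constant for far cubes; the second covers both kinds of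
    near cubes.\<close>
  define C where "C = 2 powr \<bar>\<beta>\<bar> * 2 powr \<bar>\<tau>\<bar> + (4 * D) powr D * (C1 + C2)"
  have C: "C \<ge> 0" "2 powr \<bar>\<beta>\<bar> * 2 powr \<bar>\<tau>\<bar> \<le> C" "C1 * (4 * D) powr D \<le> C" "C2 * (4 * D) powr D \<le> C"
    using C1 C2 by (auto simp: C_def algebra_simps)
  show thesis
  proof (rule that[OF C(1)])
    fix k and m :: "int ^ 'd"
    define l :: real where "l = 2 powi (- k)"
    define R where "R = cube_radius k m"
    define S where "S = dyadic_cube k m"
    define w where "w x = norm x powr \<beta> * max (norm x) 1 powr \<tau>" for x :: "real ^ 'd"
    define g where "g = R powr \<beta> * max R 1 powr \<tau>"
    have l: "l > 0" by (simp add: l_def)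
    have R: "R > 0" by (simp add: R_def cube_radius_pos)
    have g: "g \<ge> 0" by (simp add: g_def)
    have S: "S \<in> sets lebesgue" "emeasure lebesgue S = ennreal (l powr D)"
      using l by (auto simp: S_def l_def D_def emeasure_dyadic_cube powr_realpow)
    have xS: "norm x \<le> R" "R \<le> norm x + 2 * (D * l)" if "x \<in> S" for x
      using norm_dyadic_cube that unfolding S_def R_def D_def l_def by auto
    \<comment> \<open>Near cubes with a single power \<gamma> as majorant: \<gamma> = \<beta> for R
      \<le> 1 and \<gamma> = \<beta> + \<tau> for R > 1. In each case \<open>R powr \<gamma>\<close>
      is exactly \<open>g\<close>.\<close>
    have near: "weight w S \<le> ennreal (C * g * l powr D)"
      if "R \<le> 4 * D * l" "c \<ge> 0" "c * (4 * D) powr D \<le> C" "R powr \<gamma> = g"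
        and int: "(\<integral>\<^sup>+x\<in>cball (0::real ^ 'd) R. ennreal (norm x powr \<gamma>) \<partial>lebesgue) \<le> ennreal (c * R powr (\<gamma> + D))"
        and w: "\<And>x. w x \<le> norm x powr \<gamma>" for c \<gamma>
    proof -
      have "weight w S \<le> (\<integral>\<^sup>+x\<in>cball (0::real ^ 'd) R. ennreal (norm x powr \<gamma>) \<partial>lebesgue)"
        unfolding weight_def
        by (intro nn_integral_mono) (use xS w in \<open>auto simp: indicator_def intro!: ennreal_leI\<close>)
      also note int
      also have "c * R powr (\<gamma> + D) = c * (g * R powr D)"
        using that by (simp add: powr_add)
      also have "\<dots> \<le> c * (g * (4 * D * l) powr D)"
        using that D g R by (intro mult_left_mono powr_mono2) auto
      also have "\<dots> = c * (4 * D) powr D * (g * l powr D)"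
        using D l by (simp add: powr_mult)
      also have "\<dots> \<le> C * (g * l powr D)"
        using that g by (intro mult_right_mono) auto
      finally show ?thesis by (simp add: mult.assoc ennreal_leI)
    qed
    have "weight w S \<le> ennreal (C * g * l powr D)"
    proof (cases "R \<le> 4 * D * l")
      case True
      show ?thesis
      proof (cases "R \<le> 1")
        case R1: True
        have "w x \<le> norm x powr \<beta>" for x
        proof -
          have "max (norm x) 1 powr \<tau> \<le> 1 powr \<tau>"
            using assms by (intro powr_mono2') auto
          then show ?thesis by (simp add: w_def mult_left_le)
        qed
        then show ?thesis
          using R1 by (intro near[OF True C1(1) C(3) _ C1(2)[OF R]]) (auto simp: g_def)
      next
        case R1: False
        have "w x \<le> norm x powr (\<beta> + \<tau>)" for x
        \<comment> \<open>Away from 0, \<open>max (norm x) 1\<close> is at least the positive number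
          \<open>norm x\<close> and \<tau> \<le> 0; at 0 both sides vanish.\<close>
        proof (cases "x = 0")
          case False
          then have "max (norm x) 1 powr \<tau> \<le> norm x powr \<tau>"
            using assms by (intro powr_mono2') auto
          then show ?thesis by (simp add: w_def powr_add mult_left_mono)
        qed (simp add: w_def)
        then show ?thesis
          using R1 by (intro near[OF True C2(1) C(4) _ C2(2)[OF R]]) (auto simp: g_def powr_add)
      qed
    next
      case False
      have "w x \<le> C * g" if "x \<in> S" for x
      proof -
        \<comment> \<open>The threshold \<open>4 * D * l\<close> makes the error
          \<open>2 * (D * l)\<close> less than half of \<open>R\<close>.\<close>
        have x: "norm x \<le> R" "R \<le> 2 * norm x" using xS[OF that] False by auto
        have "norm x powr \<beta> \<le> 2 powr \<bar>\<beta>\<bar> * R powr \<beta>"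
          "max (norm x) 1 powr \<tau> \<le> 2 powr \<bar>\<tau>\<bar> * max R 1 powr \<tau>"
          using x R by (auto intro!: powr_le_of_comparable)
        then have "w x \<le> (2 powr \<bar>\<beta>\<bar> * R powr \<beta>) * (2 powr \<bar>\<tau>\<bar> * max R 1 powr \<tau>)"
          unfolding w_def by (intro mult_mono) auto
        also have "\<dots> = (2 powr \<bar>\<beta>\<bar> * 2 powr \<bar>\<tau>\<bar>) * g" by (simp add: g_def)
        also have "\<dots> \<le> C * g" using C g by (intro mult_right_mono) auto
        finally show ?thesis .
      qed
      then have "weight w S \<le> (\<integral>\<^sup>+x. ennreal (C * g) * indicator S x \<partial>lebesgue)"
        unfolding weight_def
        by (intro nn_integral_mono) (auto simp: indicator_def intro!: ennreal_leI)
      also have "\<dots> = ennreal (C * g * l powr D)"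
        using C g S by (simp add: nn_integral_cmult_indicator ennreal_mult)
      finally show ?thesis .
    qed
    then have "weight w S / emeasure lebesgue S \<le> ennreal (C * g * l powr D) / ennreal (l powr D)"
      unfolding S by (rule divide_right_mono_ennreal)
    also have "\<dots> = ennreal (C * g)"
      using C g l by (subst divide_ennreal) auto
    finally show "weight (\<lambda>x. norm x powr \<beta> * max (norm x) 1 powr \<tau>) (dyadic_cube k m)
        / emeasure lebesgue (dyadic_cube k m)
      \<le> ennreal (C * (cube_radius k m powr \<beta> * max (cube_radius k m) 1 powr \<tau>))"
      by (simp add: w_def[abs_def] S_def g_def R_def)
  qed
qed

text \<open>Multiplying the single bounds adds their exponents; the resulting weighted sums are
  those which the balance conditions evaluate.\<close>

lemma prod_weight_average_le:
  fixes \<beta> \<tau> s :: "'i \<Rightarrow> real" and \<sigma> :: "'i \<Rightarrow> real ^ 'd \<Rightarrow> real"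
  assumes "finite I"
    and "\<And>i. i \<in> I \<Longrightarrow> \<beta> i > - real CARD('d)"
    and "\<And>i. i \<in> I \<Longrightarrow> \<tau> i \<le> 0"
    and "\<And>i. i \<in> I \<Longrightarrow> \<beta> i + \<tau> i > - real CARD('d)"
    and s: "\<And>i. i \<in> I \<Longrightarrow> s i > 0"
    and \<sigma>: "\<And>i x. i \<in> I \<Longrightarrow> \<sigma> i x = norm x powr \<beta> i * max (norm x) 1 powr \<tau> i"
  obtains C where "C \<ge> 0"
    and "\<And>k m. (\<Prod>i\<in>I. epowr (weight (\<sigma> i) (dyadic_cube k m) / emeasure lebesgue (dyadic_cube k m)) (s i))
      \<le> ennreal (C * (cube_radius k m powr (\<Sum>i\<in>I. \<beta> i * s i)
                    * max (cube_radius k m) 1 powr (\<Sum>i\<in>I. \<tau> i * s i)))"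
proof -
  have "\<forall>i\<in>I. \<exists>C\<ge>0. \<forall>k m. weight (\<sigma> i) (dyadic_cube k m) / emeasure lebesgue (dyadic_cube k m)
      \<le> ennreal (C * (cube_radius k m powr \<beta> i * max (cube_radius k m) 1 powr \<tau> i))"
  proof
    fix i assume i: "i \<in> I"
    have eq: "\<sigma> i = (\<lambda>x. norm x powr \<beta> i * max (norm x) 1 powr \<tau> i)"
      using \<sigma>[OF i] by auto
    show "\<exists>C\<ge>0. \<forall>k m. weight (\<sigma> i) (dyadic_cube k m) / emeasure lebesgue (dyadic_cube k m)
      \<le> ennreal (C * (cube_radius k m powr \<beta> i * max (cube_radius k m) 1 powr \<tau> i))"
      unfolding eq by (rule weight_average_le[OF assms(2-4)[OF i]]) blast
  qed
  then obtain c where c: "\<And>i. i \<in> I \<Longrightarrow> c i \<ge> 0"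
    and avg: "\<And>i k m. i \<in> I \<Longrightarrow> weight (\<sigma> i) (dyadic_cube k m) / emeasure lebesgue (dyadic_cube k m)
      \<le> ennreal (c i * (cube_radius k m powr \<beta> i * max (cube_radius k m) 1 powr \<tau> i))"
    by metis
  show thesis
  proof (rule that)
    show "(\<Prod>i\<in>I. c i powr s i) \<ge> 0" by (intro prod_nonneg) auto
    fix k and m :: "int ^ 'd"
    define R where "R = cube_radius k m"
    have R: "R > 0" by (simp add: R_def cube_radius_pos)
    have "(\<Prod>i\<in>I. epowr (weight (\<sigma> i) (dyadic_cube k m) / emeasure lebesgue (dyadic_cube k m)) (s i))
      \<le> (\<Prod>i\<in>I. ennreal ((c i * (R powr \<beta> i * max R 1 powr \<tau> i)) powr s i))"
      unfolding R_def by (intro prod_mono_ennreal epowr_le avg s)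
    also have "\<dots> = ennreal (\<Prod>i\<in>I. (c i * (R powr \<beta> i * max R 1 powr \<tau> i)) powr s i)"
      by (intro prod_ennreal) auto
    also have "(\<Prod>i\<in>I. (c i * (R powr \<beta> i * max R 1 powr \<tau> i)) powr s i)
      = (\<Prod>i\<in>I. c i powr s i * (R powr (\<beta> i * s i) * max R 1 powr (\<tau> i * s i)))"
      using c by (intro prod.cong) (auto simp: powr_mult powr_powr)
    also have "\<dots> = (\<Prod>i\<in>I. c i powr s i)
        * (R powr (\<Sum>i\<in>I. \<beta> i * s i) * max R 1 powr (\<Sum>i\<in>I. \<tau> i * s i))"
      using R assms(1) by (subst (1 2) powr_sum) (auto simp: prod.distrib)
    finally show "(\<Prod>i\<in>I. epowr (weight (\<sigma> i) (dyadic_cube k m) / emeasure lebesgue (dyadic_cube k m)) (s i))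
      \<le> ennreal ((\<Prod>i\<in>I. c i powr s i) * (cube_radius k m powr (\<Sum>i\<in>I. \<beta> i * s i)
                    * max (cube_radius k m) 1 powr (\<Sum>i\<in>I. \<tau> i * s i)))"
      unfolding R_def .
  qed
qed

(* In the first part the condition 0 <= alpha + d (1 - sum 1/p_i) is added to the source's
   hypotheses: without it the claim fails for the family of unit dyadic cubes, since every
   |x|^beta_i is essentially constant on a cube far from 0 and the product of the averages
   is of order |x|^(-alpha - d (1 - sum 1/p_i)). *)
theorem theorem1p3:
  fixes n :: nat and p :: "nat \<Rightarrow> real" and \<alpha> \<eta> :: real
    and F :: "(real ^ 'd) set set" and E :: "(real ^ 'd) set \<Rightarrow> (real ^ 'd) set"
    and K :: "(real ^ 'd) set \<Rightarrow> real"
  assumes "n \<ge> 2"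
    and "\<forall>i\<in>{1..n}. 1 < p i"
    and "0 < \<eta>" and "\<eta> < 1"
    and "sparse_family \<eta> F E"
    and "0 < \<alpha>" and "\<alpha> < (real n - 1) * real CARD('d)"
    and "\<forall>S\<in>F. K S = side_length S powr (\<alpha> - (real n - 1) * real CARD('d))"
  shows
    "((\<Sum>i=1..n. 1 / p i) \<ge> 1 \<longrightarrow>
        (\<forall>(\<beta> :: nat \<Rightarrow> real) (\<sigma> :: nat \<Rightarrow> real ^ 'd \<Rightarrow> real).
           (\<forall>i\<in>{1..n}. \<beta> i > - real CARD('d)) \<and>
           (\<forall>i\<in>{1..n}. \<forall>x. \<sigma> i x = norm x powr \<beta> i) \<and>
           0 \<le> \<alpha> + real CARD('d) * (1 - (\<Sum>i=1..n. 1 / p i)) \<and>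
           \<alpha> + real CARD('d) * (1 - (\<Sum>i=1..n. 1 / p i))
             + (\<Sum>i=1..n. \<beta> i / conjugate_exponent (p i)) = 0 \<longrightarrow>
           (SUP S\<in>F. ennreal (K S * measure lebesgue S powr (real n - (\<Sum>i=1..n. 1 / p i)))
              * (\<Prod>i=1..n. epowr (weight (\<sigma> i) S / emeasure lebesgue S)
                              (1 / conjugate_exponent (p i)))) < \<infinity>))
     \<and>
     ((\<Sum>i=1..n. 1 / p i) < 1 \<longrightarrow>
        (\<forall>(r :: real) (\<rho> :: real) (\<beta> :: nat \<Rightarrow> real) (\<sigma> :: nat \<Rightarrow> real ^ 'd \<Rightarrow> real).
           1 / r + (\<Sum>i=1..n. 1 / p i) = 1 \<and>
           \<rho> < - real CARD('d) / r \<and>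
           (\<forall>i\<in>{1..n}. \<beta> i + conjugate_exponent (p i) * \<rho> / real n > - real CARD('d)) \<and>
           (\<forall>i\<in>{1..n}. \<forall>x. \<sigma> i x =
              norm x powr \<beta> i * max (norm x) 1 powr (conjugate_exponent (p i) * \<rho> / real n)) \<and>
           \<alpha> + (\<Sum>i=1..n. \<beta> i / conjugate_exponent (p i)) = 0 \<longrightarrow>
           epowr (\<Sum>\<^sub>\<infinity>S\<in>F.
              epowr (ennreal (K S * measure lebesgue S ^ (n - 1))
                 * (\<Prod>i=1..n. epowr (weight (\<sigma> i) S / emeasure lebesgue S)
                                 (1 / conjugate_exponent (p i)))) r
              * emeasure lebesgue (E S)) (1 / r) < \<infinity>))"
proof (intro conjI impI allI; elim conjE)
  define D where "D = real CARD('d)"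
  define P where "P = (\<Sum>i=1..n. 1 / p i)"
  have p': "conjugate_exponent (p i) > 0" if "i \<in> {1..n}" for i
  proof -
    have "1 < p i" using assms(2) that by blast
    then show ?thesis by (simp add: conjugate_exponent_def)
  qed
  \<comment> \<open>Volume and kernel become powers of the side length; the indices are kept because
    \<open>cube_radius\<close> depends on them.\<close>
  have cube: "\<exists>k m. S = dyadic_cube k m \<and> 0 < side_length S
      \<and> side_length S = 2 powi (- k) \<and> side_length S \<le> cube_radius k m
      \<and> measure lebesgue S = side_length S powr D
      \<and> K S = side_length S powr (\<alpha> - (real n - 1) * D)" if S: "S \<in> F" for S
  proof -
    obtain k m where km: "S = dyadic_cube k m"
      using S assms(5) by (auto simp: sparse_family_def dyadic_cubes_def)
    then have "measure lebesgue S = side_length S powr D"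
      by (simp add: measure_def emeasure_dyadic_cube side_length_dyadic_cube D_def powr_realpow)
    then show ?thesis
      using S assms(8) side_le_cube_radius[of k m]
      by (intro exI[of _ k] exI[of _ m]) (auto simp: km side_length_dyadic_cube D_def)
  qed
  {

    \<comment> \<open>The supremum bound for pure power weights\<close>
    fix \<beta> :: "nat \<Rightarrow> real" and \<sigma> :: "nat \<Rightarrow> real ^ 'd \<Rightarrow> real"
    let ?Q = "\<lambda>S. \<Prod>i=1..n. epowr (weight (\<sigma> i) S / emeasure lebesgue S) (1 / conjugate_exponent (p i))"
    assume \<beta>: "\<forall>i\<in>{1..n}. \<beta> i > - real CARD('d)"
      and \<sigma>: "\<forall>i\<in>{1..n}. \<forall>x. \<sigma> i x = norm x powr \<beta> i"
      and nonneg: "0 \<le> \<alpha> + real CARD('d) * (1 - (\<Sum>i=1..n. 1 / p i))"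
      and zero: "\<alpha> + real CARD('d) * (1 - (\<Sum>i=1..n. 1 / p i))
             + (\<Sum>i=1..n. \<beta> i / conjugate_exponent (p i)) = 0"
    define \<gamma> where "\<gamma> = \<alpha> + D * (1 - P)"
    have \<gamma>: "\<gamma> \<ge> 0" "(\<Sum>i=1..n. \<beta> i * (1 / conjugate_exponent (p i))) = - \<gamma>"
      using nonneg zero by (simp_all add: \<gamma>_def D_def P_def)
    \<comment> \<open>With \<tau> = 0 the factor \<open>max y 1 powr 0\<close> must reduce to 1,
      which needs a nonzero base because \<open>0 powr 0 = 0\<close>.\<close>
    have max_ne: "max y 1 \<noteq> 0" for y :: real by linarith
    obtain C where C: "C \<ge> 0" and Q: "\<And>k m. ?Q (dyadic_cube k m) \<le> ennreal (C * cube_radius k m powr (- \<gamma>))"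
    proof (rule prod_weight_average_le[of "{1..n}" \<beta> "\<lambda>_. 0" "\<lambda>i. 1 / conjugate_exponent (p i)" \<sigma>])
      fix C assume "C \<ge> 0" and "\<And>k m. ?Q (dyadic_cube k m)
        \<le> ennreal (C * (cube_radius k m powr (\<Sum>i=1..n. \<beta> i * (1 / conjugate_exponent (p i)))
          * max (cube_radius k m) 1 powr (\<Sum>i=1..n. 0 * (1 / conjugate_exponent (p i)))))"
      then show thesis
        unfolding \<gamma>(2) by (intro that[of C]) (simp_all add: max_ne)
    qed (use \<beta> \<sigma> p' max_ne in auto)
    have "ennreal (K S * measure lebesgue S powr (real n - P)) * ?Q S \<le> ennreal C" if S: "S \<in> F" for S
    proof -
      define l where "l = side_length S"
      obtain k m where km: "S = dyadic_cube k m" and l: "0 < l" "l \<le> cube_radius k m"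
        and meas: "measure lebesgue S = l powr D" and K: "K S = l powr (\<alpha> - (real n - 1) * D)"
        using cube[OF S] unfolding l_def by blast
      \<comment> \<open>Exponents add up: (\<alpha> - (n - 1) D) + D (n - P) = \<alpha> + D (1 -
        P).\<close>
      have "K S * measure lebesgue S powr (real n - P) = l powr \<gamma>"
        by (simp add: meas K powr_powr \<gamma>_def algebra_simps flip: powr_add)
      then have "ennreal (K S * measure lebesgue S powr (real n - P)) * ?Q S
          \<le> ennreal (l powr \<gamma>) * ennreal (C * cube_radius k m powr (- \<gamma>))"
        unfolding km by (intro mult_mono Q) auto
      also have "\<dots> = ennreal (C * (l powr \<gamma> * cube_radius k m powr (- \<gamma>)))"
        using C by (simp add: mult_ac flip: ennreal_mult)
      \<comment> \<open>Here \<gamma> \<ge> 0 enters: the radius is at least \<open>l\<close>, so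
        its power with exponent -\<gamma> is at most that of \<open>l\<close>.\<close>
      also have "l powr \<gamma> * cube_radius k m powr (- \<gamma>) \<le> l powr \<gamma> * l powr (- \<gamma>)"
        using l \<gamma> by (intro mult_left_mono powr_mono2') auto
      also have "\<dots> = 1" using l by (simp flip: powr_add)
      finally show ?thesis using C by (simp add: ennreal_leI mult_left_mono)
    qed
    then show "(SUP S\<in>F. ennreal (K S * measure lebesgue S powr (real n - (\<Sum>i=1..n. 1 / p i))) * ?Q S) < \<infinity>"
      unfolding P_def by (intro le_less_trans[OF SUP_least, of _ _ "ennreal C"]) auto
  next

    \<comment> \<open>The r-summability bound for weights damped at infinity\<close>
    fix r \<rho> :: real and \<beta> :: "nat \<Rightarrow> real" and \<sigma> :: "nat \<Rightarrow> real ^ 'd \<Rightarrow> real"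
    let ?Q = "\<lambda>S. \<Prod>i=1..n. epowr (weight (\<sigma> i) S / emeasure lebesgue S) (1 / conjugate_exponent (p i))"
    assume P1: "(\<Sum>i=1..n. 1 / p i) < 1"
      and r_def: "1 / r + (\<Sum>i=1..n. 1 / p i) = 1"
      and \<rho>: "\<rho> < - real CARD('d) / r"
      and \<beta>: "\<forall>i\<in>{1..n}. \<beta> i + conjugate_exponent (p i) * \<rho> / real n > - real CARD('d)"
      and \<sigma>: "\<forall>i\<in>{1..n}. \<forall>x. \<sigma> i x =
              norm x powr \<beta> i * max (norm x) 1 powr (conjugate_exponent (p i) * \<rho> / real n)"
      and zero: "\<alpha> + (\<Sum>i=1..n. \<beta> i / conjugate_exponent (p i)) = 0"
    have r: "r > 0" using P1 r_def by (smt (verit) zero_less_divide_1_iff)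
    have \<rho>r: "\<rho> * r < - real DIM(real ^ 'd)" using \<rho> r by (simp add: field_simps)
    have \<rho>0: "\<rho> < 0" using \<rho> r by (smt (verit) divide_nonneg_pos of_nat_0_le_iff minus_divide_left)
    define \<tau> where "\<tau> i = conjugate_exponent (p i) * \<rho> / real n" for i
    have \<tau>: "\<tau> i \<le> 0" if "i \<in> {1..n}" for i
      using p'[OF that] \<rho>0 by (simp add: \<tau>_def divide_nonpos_nonneg mult_nonneg_nonpos)
    \<comment> \<open>The conjugate exponent cancels, so each of the n weights contributes an equal
      share of \<rho>.\<close>
    have "(\<Sum>i=1..n. \<tau> i * (1 / conjugate_exponent (p i))) = (\<Sum>i=1..n. \<rho> / real n)"
      using p' by (intro sum.cong) (fastforce simp: \<tau>_def)+
    then have sums: "(\<Sum>i=1..n. \<tau> i * (1 / conjugate_exponent (p i))) = \<rho>"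
      "(\<Sum>i=1..n. \<beta> i * (1 / conjugate_exponent (p i))) = - \<alpha>"
      using assms(1) zero by simp_all
    obtain C where C: "C \<ge> 0" and Q: "\<And>k m. ?Q (dyadic_cube k m)
        \<le> ennreal (C * (cube_radius k m powr (- \<alpha>) * max (cube_radius k m) 1 powr \<rho>))"
    proof (rule prod_weight_average_le[of "{1..n}" \<beta> \<tau> "\<lambda>i. 1 / conjugate_exponent (p i)" \<sigma>, unfolded sums])
      fix i assume i: "i \<in> {1..n}"
      show "\<beta> i + \<tau> i > - real CARD('d)" using \<beta> i by (simp add: \<tau>_def)
      \<comment> \<open>Integrability at the origin follows from the condition on the sum, since
        \<tau> is nonpositive.\<close>
      then show "\<beta> i > - real CARD('d)" using \<tau>[OF i] by linarith
    qed (use \<tau> \<sigma> p' in \<open>auto simp: \<tau>_def\<close>)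
    \<comment> \<open>The integrable majorant: a term of the sum is at most the integral of
      \<open>h\<close> over its set \<open>E S\<close>.\<close>
    define h where "h x = ennreal (C powr r) * ennreal (max (norm x) 1 powr (\<rho> * r))" for x :: "real ^ 'd"
    have h: "h \<in> borel_measurable lebesgue"
      unfolding h_def[abs_def] by (intro measurable_completion) measurable
    have sparse: "E S \<in> sets lebesgue" "E S \<subseteq> S" if "S \<in> F" for S
      using assms(5) that by (auto simp: sparse_family_def)
    have term_le: "epowr (ennreal (K S * measure lebesgue S ^ (n - 1)) * ?Q S) r * emeasure lebesgue (E S)
        \<le> (\<integral>\<^sup>+x\<in>E S. h x \<partial>lebesgue)" if S: "S \<in> F" for S
    proof -
      define l where "l = side_length S"
      obtain k m where km: "S = dyadic_cube k m" and l: "0 < l" "l \<le> cube_radius k m"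
        and meas: "measure lebesgue S = l powr D" and K: "K S = l powr (\<alpha> - (real n - 1) * D)"
        using cube[OF S] unfolding l_def by blast
      define R where "R = cube_radius k m"
      \<comment> \<open>The subtraction \<open>n - 1\<close> is on naturals and agrees with the real
        one because n \<ge> 2; this power then cancels the (n - 1) D in the exponent of
        \<open>K\<close>.\<close>
      have "(l powr D) ^ (n - 1) = l powr ((real n - 1) * D)"
        using assms(1) l
        by (subst powr_realpow[symmetric]) (auto simp: powr_powr mult.commute of_nat_diff)
      then have "K S * measure lebesgue S ^ (n - 1) = l powr \<alpha>"
        by (simp add: meas K flip: powr_add)
      then have "ennreal (K S * measure lebesgue S ^ (n - 1)) * ?Q S
          \<le> ennreal (l powr \<alpha>) * ennreal (C * (R powr (- \<alpha>) * max R 1 powr \<rho>))"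
        unfolding km R_def by (intro mult_mono Q) auto
      also have "\<dots> = ennreal ((l powr \<alpha> * R powr (- \<alpha>)) * (C * max R 1 powr \<rho>))"
        using C by (simp add: mult_ac flip: ennreal_mult)
      also have "\<dots> \<le> ennreal (1 * (C * max R 1 powr \<rho>))"
      proof (intro ennreal_leI mult_right_mono)
        have "l powr \<alpha> * R powr (- \<alpha>) \<le> l powr \<alpha> * l powr (- \<alpha>)"
          using l assms(6) unfolding R_def by (intro mult_left_mono powr_mono2') auto
        also have "\<dots> = 1" using l by (simp flip: powr_add)
        finally show "l powr \<alpha> * R powr (- \<alpha>) \<le> 1" .
      qed (use C in auto)
      finally have "epowr (ennreal (K S * measure lebesgue S ^ (n - 1)) * ?Q S) r
          \<le> ennreal ((C * max R 1 powr \<rho>) powr r)"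
        using r by (intro epowr_le) auto
      also have "(C * max R 1 powr \<rho>) powr r = C powr r * max R 1 powr (\<rho> * r)"
        using C by (simp add: powr_mult powr_powr)
      finally have "epowr (ennreal (K S * measure lebesgue S ^ (n - 1)) * ?Q S) r * emeasure lebesgue (E S)
          \<le> ennreal (C powr r * max R 1 powr (\<rho> * r)) * emeasure lebesgue (E S)"
        by (rule mult_right_mono) simp
      also have "\<dots> = (\<integral>\<^sup>+x. ennreal (C powr r * max R 1 powr (\<rho> * r)) * indicator (E S) x \<partial>lebesgue)"
        using sparse[OF S] by (simp add: nn_integral_cmult_indicator)
      also have "\<dots> \<le> (\<integral>\<^sup>+x\<in>E S. h x \<partial>lebesgue)"
      proof -
        \<comment> \<open>As \<rho> r \<le> 0, \<open>h\<close> decreases in |x|, so its value at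
          radius R is a lower bound on the cube and the constant can be moved under the
          integral.\<close>
        have "ennreal (C powr r * max R 1 powr (\<rho> * r)) \<le> h x" if "x \<in> E S" for x
        proof -
          have "norm x \<le> R"
            using that sparse[OF S] norm_dyadic_cube(1) unfolding km R_def by blast
          moreover have "\<rho> * r \<le> 0" using \<rho>0 r by (simp add: mult_nonpos_nonneg)
          ultimately have "max R 1 powr (\<rho> * r) \<le> max (norm x) 1 powr (\<rho> * r)"
            by (intro powr_mono2') auto
          then show ?thesis
            by (simp add: h_def ennreal_leI mult_left_mono flip: ennreal_mult)
        qed
        then show ?thesis
          by (intro nn_integral_mono) (auto simp: indicator_def)
      qed
      finally show ?thesis .
    qed
    have "(\<Sum>\<^sub>\<infinity>S\<in>F. epowr (ennreal (K S * measure lebesgue S ^ (n - 1)) * ?Q S) r * emeasure lebesgue (E S))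
        \<le> (\<Sum>\<^sub>\<infinity>S\<in>F. \<integral>\<^sup>+x\<in>E S. h x \<partial>lebesgue)"
      by (intro infsum_mono term_le nonneg_summable_on_complete) auto
    also have "\<dots> \<le> (\<integral>\<^sup>+x. h x \<partial>lebesgue)"
      using assms(5) sparse by (intro infsum_nn_integral_disjoint_le h) (auto simp: sparse_family_def)
    also have "\<dots> = ennreal (C powr r) * (\<integral>\<^sup>+(x :: real ^ 'd). ennreal (max (norm x) 1 powr (\<rho> * r)) \<partial>lebesgue)"
      unfolding h_def by (intro nn_integral_cmult measurable_completion) measurable
    also have "\<dots> < \<infinity>"
      using nn_integral_max_norm_powr_finite[OF \<rho>r] by (simp add: ennreal_mult_less_top)
    finally show "epowr (\<Sum>\<^sub>\<infinity>S\<in>F. epowr (ennreal (K S * measure lebesgue S ^ (n - 1)) * ?Q S) r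
        * emeasure lebesgue (E S)) (1 / r) < \<infinity>"
      by (simp add: epowr_def)
  }
qed

end
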